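(* Let $\mathcal A$ be a $\mathcal B(\mathcal H,\mathcal K)$-valued frame sequence with lower frame bound $\alpha$, let $\mathcal B$ be a $\mu$-perturbation of $\mathcal A$ with $0<\mu<\sqrt{\alpha}$, and assume that the gap $\Delta:=\Delta(\mathcal H_{\mathcal A},\mathcal H_{\mathcal B})$ satisfies $\Delta<1$. Then $\mathcal B$ is a $\mathcal B(\mathcal H,\mathcal K)$-valued frame sequence, and for the canonical duals $\widetilde{\mathcal A}$ and $\widetilde{\mathcal B}$ of $\mathcal A$ and $\mathcal B$, respectively, we have $$\left\|T_{\widetilde{\mathcal A}}-T_{\widetilde{\mathcal B}}\right\|\le\frac{2\mu+(2\sqrt{\alpha}-\mu)\Delta}{\sqrt{\alpha}\,(\sqrt{\alpha}-\mu)}.$$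
   Context: $\mathcal H,\mathcal K$ are Hilbert spaces, $I\subset\mathbb N$ is a finite or countable index set, and $\mathfrak K:=\ell^2(I,\mathcal K)$ is the Hilbert space of square-summable $\mathcal K$-valued sequences. $\mathcal B(X,Y)$ denotes the bounded everywhere defined linear operators $X\to Y$, with the operator norm; $P_V$ is the orthogonal projection onto a closed subspace $V$. A sequence $\mathcal A=(A_i)_{i\in I}\subset\mathcal B(\mathcal H,\mathcal K)$ is a $\mathcal B(\mathcal H,\mathcal K)$-valued Bessel sequence if there is $\beta>0$ with $\sum_{i\in I}\|A_ix\|^2\le\beta\|x\|^2$ for all $x\in\mathcal H$. Put $\mathcal H_{\mathcal A}:=\overline{\operatorname{span}}\{\operatorname{ran}A_i^*: i\in I\}$ and $P_{\mathcal A}:=P_{\mathcal H_{\mathcal A}}$. The analysis operator is $T_{\mathcal A}\in\mathcal B(\mathcal H,\mathfrak K)$, $T_{\mathcal A}x=(A_ix)_{i\in I}$, and the frame operator is $S_{\mathcal A}:=T_{\mathcal A}^*T_{\mathcal A}$. $\mathcal A$ is a $\mathcal B(\mathcal H,\mathcal K)$-valued frame sequence with lower and upper frame bounds $\alpha,\beta>0$ if $\alpha\|x\|^2\le\sum_{i\in I}\|A_ix\|^2\le\beta\|x\|^2$ for all $x\in\mathcal H_{\mathcal A}$; then $S_{\mathcal A}$ maps $\mathcal H_{\mathcal A}$ into itself and $S_{\mathcal A}|\mathcal H_{\mathcal A}$ is boundedly invertible on $\mathcal H_{\mathcal A}$. The canonical dual of an operator-valued frame sequence $\mathcal A$ is $\widetilde{\mathcal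 A}:=(A_i(S_{\mathcal A}|\mathcal H_{\mathcal A})^{-1}P_{\mathcal A})_{i\in I}$; its analysis operator is $T_{\mathcal A}(S_{\mathcal A}|\mathcal H_{\mathcal A})^{-1}P_{\mathcal A}$. For $\mu>0$, a $\mathcal B(\mathcal H,\mathcal K)$-valued Bessel sequence $\mathcal B$ is a $\mu$-perturbation of the $\mathcal B(\mathcal H,\mathcal K)$-valued Bessel sequence $\mathcal A$ if $\|T_{\mathcal A}-T_{\mathcal B}\|\le\mu$. For closed subspaces $V,W$ of $\mathcal H$, $\delta(V,W):=\|(I-P_W)|V\|$ and the gap between $V$ and $W$ is $\Delta(V,W):=\max\{\delta(V,W),\delta(W,V)\}$, which equals $\|P_V-P_W\|$. *)

theory Defs
  imports "HOL-Analysis.Analysis"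
begin

section \<open>Scalars\<close>

text \<open>
  Up to isomorphism \<^typ>\<open>real\<close> and \<^typ>\<open>complex\<close> are the only members of this class, so that
  everything below covers real and complex Hilbert spaces simultaneously.
\<close>

class rc_field = real_normed_field + banach +
  fixes conjg :: "'a \<Rightarrow> 'a"
  assumes conjg_add: "conjg (a + b) = conjg a + conjg b"
    and conjg_mult: "conjg (a * b) = conjg a * conjg b"
    and conjg_conjg: "conjg (conjg a) = a"
    and mult_conjg_scaleR: "a * conjg a = (norm a)\<^sup>2 *\<^sub>R 1"

lemma mult_conjg: "a * conjg a = of_real ((norm (a :: 'a :: rc_field))\<^sup>2)"
  by (simp only: mult_conjg_scaleR of_real_def)

instantiation real :: rc_field
begin
definition conjg_real :: "real \<Rightarrow> real" where "conjg_real x = x"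
instance by standard (simp_all add: conjg_real_def power2_eq_square)
end

instantiation complex :: rc_field
begin
definition conjg_complex :: "complex \<Rightarrow> complex" where "conjg_complex = cnj"
instance
  by standard
    (simp_all add: conjg_complex_def scaleR_conv_of_real complex_norm_square[symmetric]
      del: of_real_power)
end

lemma norm_conjg: "norm (conjg a) = norm (a :: 'a :: rc_field)"
proof (cases "a = 0")
  case True
  have "conjg (0::'a) + conjg 0 = conjg 0" by (metis conjg_add add_0)
  then show ?thesis using True by simp
next
  case False
  have "norm a * norm (conjg a) = (norm a)\<^sup>2"
    by (metis mult_conjg norm_mult norm_of_real abs_power2)
  then show ?thesis using False by (simp add: power2_eq_square)
qed

lemma conjg_of_real: "conjg (of_real r) = (of_real r :: 'a :: rc_field)"
proof (cases "r = 0")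
  case True
  then show ?thesis using norm_conjg[of "0::'a"] by simp
next
  case False
  have "of_real r * conjg (of_real r) = (of_real r * of_real r :: 'a)"
    by (simp add: mult_conjg power2_eq_square)
  then show ?thesis using False by simp
qed

lemma bounded_linear_conjg: "bounded_linear (conjg :: 'a :: rc_field \<Rightarrow> 'a)"
  by (rule bounded_linear_intro[where K = 1])
    (simp_all add: conjg_add scaleR_conv_of_real conjg_mult conjg_of_real norm_conjg)


section \<open>Hilbert spaces\<close>

record ('f, 'h) inner_structure =
  hscale :: "'f \<Rightarrow> 'h \<Rightarrow> 'h"
  hinner :: "'h \<Rightarrow> 'h \<Rightarrow> 'f"

text \<open>
  Addition, norm and completeness come from the type class \<^class>\<open>banach\<close>; the inner product is linear
  in the first argument and induces the norm.
\<close>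

locale hilbert_space =
  fixes H :: "('f::rc_field, 'h::banach) inner_structure"
  assumes vector_space: "vector_space (hscale H)"
    and scale_of_real: "hscale H (of_real r) x = r *\<^sub>R x"
    and inner_add_left: "hinner H (x + y) z = hinner H x z + hinner H y z"
    and inner_scale_left: "hinner H (hscale H c x) y = c * hinner H x y"
    and inner_conjg: "hinner H y x = conjg (hinner H x y)"
    and inner_self: "hinner H x x = of_real ((norm x)\<^sup>2)"

context hilbert_space
begin

lemma inner_add_right: "hinner H x (y + z) = hinner H x y + hinner H x z"
  by (metis inner_conjg inner_add_left conjg_add)

lemma inner_scale_right: "hinner H x (hscale H c y) = conjg c * hinner H x y"
  by (metis inner_conjg inner_scale_left conjg_mult)

lemma norm_scale: "norm (hscale H c x) = norm c * norm x"
proof -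
  have "of_real ((norm (hscale H c x))\<^sup>2) = c * (conjg c * hinner H x x)"
    by (simp only: inner_self[symmetric] inner_scale_left inner_scale_right ac_simps)
  also have "\<dots> = of_real ((norm c * norm x)\<^sup>2)"
    by (simp only: inner_self mult.assoc[symmetric] mult_conjg of_real_mult[symmetric]
        power_mult_distrib)
  finally show ?thesis
    by (simp only: of_real_eq_iff) simp
qed

lemma Cauchy_Schwarz: "norm (hinner H x y) \<le> norm x * norm y"
proof (cases "y = 0")
  case True
  have "hinner H x 0 + hinner H x 0 = hinner H x 0" by (metis inner_add_right add_0)
  then show ?thesis using True by simp
next
  case False
  define a where "a = hinner H x y"
  define n where "n = (norm y)\<^sup>2"
  have n: "n > 0" using False by (simp add: n_def)
  define c where "c = - (a / of_real n)"
  have cn: "c * of_real n = - a" using n by (simp add: c_def)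
  have cj: "hinner H y x = conjg a" by (simp add: a_def inner_conjg[of y x])
  have "of_real ((norm (x + hscale H c y))\<^sup>2)
      = of_real ((norm x)\<^sup>2) + conjg c * a + c * conjg a + c * (conjg c * of_real n)"
    unfolding inner_self[symmetric] n_def
    by (simp add: inner_add_left inner_add_right inner_scale_left inner_scale_right cj a_def
        algebra_simps)
  also have "\<dots> = of_real ((norm x)\<^sup>2) + c * conjg a + conjg c * (a + c * of_real n)"
    by (simp add: algebra_simps)
  also have "\<dots> = of_real ((norm x)\<^sup>2) - (a * conjg a) / of_real n"
    by (simp add: cn) (simp add: c_def)
  also have "\<dots> = of_real ((norm x)\<^sup>2 - (norm a)\<^sup>2 / n)"
    by (simp add: mult_conjg)
  finally have "(norm (x + hscale H c y))\<^sup>2 = (norm x)\<^sup>2 - (norm a)\<^sup>2 / n"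
    by (simp only: of_real_eq_iff)
  then have "(norm a)\<^sup>2 / n \<le> (norm x)\<^sup>2" by (metis diff_ge_0_iff_ge zero_le_power2)
  then have "(norm a)\<^sup>2 \<le> (norm x * norm y)\<^sup>2"
    using n by (simp add: field_simps n_def power_mult_distrib)
  then show ?thesis unfolding a_def by (rule power2_le_imp_le) simp
qed

end

definition bounded_operator ::
  "('f, 'h::real_normed_vector) inner_structure \<Rightarrow> ('f, 'k::real_normed_vector) inner_structure
    \<Rightarrow> ('h \<Rightarrow> 'k) \<Rightarrow> bool" where
  "bounded_operator H K A \<longleftrightarrow>
     bounded_linear A \<and> (\<forall>c x. A (hscale H c x) = hscale K c (A x))"

definition adj ::
  "('f, 'h) inner_structure \<Rightarrow> ('f, 'k) inner_structure \<Rightarrow> ('h \<Rightarrow> 'k) \<Rightarrow> 'k \<Rightarrow> 'h" where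
  "adj H K A = (THE A'. \<forall>x y. hinner K (A x) y = hinner H x (A' y))"

definition orth_proj ::
  "('f::zero, 'h::minus) inner_structure \<Rightarrow> 'h set \<Rightarrow> 'h \<Rightarrow> 'h" where
  "orth_proj H V x = (THE p. p \<in> V \<and> (\<forall>v\<in>V. hinner H (x - p) v = 0))"

text \<open>For \<open>V = UNIV\<close> this is \<^const>\<open>onorm\<close>.\<close>

definition onorm_on :: "'h::real_normed_vector set \<Rightarrow> ('h \<Rightarrow> 'k::real_normed_vector) \<Rightarrow> real" where
  "onorm_on V f = (SUP x\<in>V. norm (f x) / norm x)"

definition delta ::
  "('f::zero, 'h::real_normed_vector) inner_structure \<Rightarrow> 'h set \<Rightarrow> 'h set \<Rightarrow> real" where
  "delta H V W = onorm_on V (\<lambda>x. x - orth_proj H W x)"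

definition gap ::
  "('f::zero, 'h::real_normed_vector) inner_structure \<Rightarrow> 'h set \<Rightarrow> 'h set \<Rightarrow> real" where
  "gap H V W = max (delta H V W) (delta H W V)"


section \<open>Square-summable sequences\<close>

text \<open>
  The space \<open>\<ell>\<^sup>2(I, K)\<close> for \<open>I \<subseteq> \<nat>\<close> is identified with the closed subspace of \<open>\<ell>\<^sup>2(\<nat>, K)\<close> of all
  sequences vanishing outside \<open>I\<close>.
\<close>

typedef (overloaded) 'k ell2 =
  "{f :: nat \<Rightarrow> 'k::real_normed_vector. (\<lambda>i. (norm (f i))\<^sup>2) summable_on UNIV}"
  morphisms ell2_nth Abs_ell2
  by (rule exI[of _ "\<lambda>_. 0"]) simp

setup_lifting type_definition_ell2

lemma ell2_summable: "(\<lambda>i. (norm (ell2_nth f i))\<^sup>2) summable_on UNIV"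
  using ell2_nth[of f] by simp

lemma norm_add_sq_le: "(norm (a + b))\<^sup>2 \<le> 2 * (norm a)\<^sup>2 + 2 * (norm (b :: 'k::real_normed_vector))\<^sup>2"
proof -
  have "(norm (a + b))\<^sup>2 \<le> (norm a + norm b)\<^sup>2"
    by (intro power_mono norm_triangle_ineq) simp
  also have "\<dots> \<le> 2 * (norm a)\<^sup>2 + 2 * (norm b)\<^sup>2"
    using sum_squares_bound[of "norm a" "norm b"] by (simp add: power2_sum)
  finally show ?thesis .
qed

lemma sq_summable_add:
  fixes f g :: "nat \<Rightarrow> 'k::real_normed_vector"
  assumes "(\<lambda>i. (norm (f i))\<^sup>2) summable_on UNIV" "(\<lambda>i. (norm (g i))\<^sup>2) summable_on UNIV"
  shows "(\<lambda>i. (norm (f i + g i))\<^sup>2) summable_on UNIV"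
proof (rule summable_on_comparison_test)
  show "(\<lambda>i. 2 * (norm (f i))\<^sup>2 + 2 * (norm (g i))\<^sup>2) summable_on UNIV"
    by (intro summable_on_add summable_on_cmult_right assms)
qed (simp_all add: norm_add_sq_le)

instantiation ell2 :: (real_normed_vector) real_normed_vector
begin

lift_definition zero_ell2 :: "'a ell2" is "\<lambda>_. 0" by simp
lift_definition plus_ell2 :: "'a ell2 \<Rightarrow> 'a ell2 \<Rightarrow> 'a ell2" is "\<lambda>f g i. f i + g i"
  by (rule sq_summable_add)
lift_definition uminus_ell2 :: "'a ell2 \<Rightarrow> 'a ell2" is "\<lambda>f i. - f i" by simp
lift_definition minus_ell2 :: "'a ell2 \<Rightarrow> 'a ell2 \<Rightarrow> 'a ell2" is "\<lambda>f g i. f i - g i"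
  subgoal for f g using sq_summable_add[of f "\<lambda>i. - g i"] by simp
  done
lift_definition scaleR_ell2 :: "real \<Rightarrow> 'a ell2 \<Rightarrow> 'a ell2" is "\<lambda>r f i. r *\<^sub>R f i"
  by (simp add: power_mult_distrib summable_on_cmult_right)
lift_definition norm_ell2 :: "'a ell2 \<Rightarrow> real" is "\<lambda>f. sqrt (\<Sum>\<^sub>\<infinity>i. (norm (f i))\<^sup>2)" .

definition sgn_ell2 :: "'a ell2 \<Rightarrow> 'a ell2" where "sgn_ell2 x = inverse (norm x) *\<^sub>R x"
definition dist_ell2 :: "'a ell2 \<Rightarrow> 'a ell2 \<Rightarrow> real" where "dist_ell2 x y = norm (x - y)"
definition uniformity_ell2 :: "('a ell2 \<times> 'a ell2) filter" where
  "uniformity_ell2 = (INF e\<in>{0<..}. principal {(x, y). dist x y < e})"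
definition open_ell2 :: "'a ell2 set \<Rightarrow> bool" where
  "open_ell2 U \<longleftrightarrow> (\<forall>x\<in>U. \<forall>\<^sub>F (x', y) in uniformity. x' = x \<longrightarrow> y \<in> U)"

lemma L2_set_le_ell2: "finite F \<Longrightarrow> L2_set (\<lambda>i. norm (ell2_nth f i)) F \<le> norm f"
  unfolding L2_set_def norm_ell2.rep_eq
  by (intro real_sqrt_le_mono finite_sum_le_infsum ell2_summable) simp_all

lemma norm_ell2_le:
  assumes "\<And>F. finite F \<Longrightarrow> L2_set (\<lambda>i. norm (ell2_nth f i)) F \<le> b"
  shows "norm f \<le> b"
proof -
  have b: "0 \<le> b" using assms[of "{}"] by simp
  have "(\<Sum>\<^sub>\<infinity>i. (norm (ell2_nth f i))\<^sup>2) \<le> b\<^sup>2"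
    by (rule infsum_le_finite_sums[OF ell2_summable])
      (use assms in \<open>simp add: L2_set_def sqrt_le_D\<close>)
  then show ?thesis unfolding norm_ell2.rep_eq using b by (rule real_le_lsqrt[rotated]) 
qed

instance
proof
  fix x y z :: "'a ell2" and r s :: real
  show "x + y + z = x + (y + z)" "x + y = y + x" "0 + x = x" "- x + x = 0" "x - y = x + - y"
    "r *\<^sub>R (x + y) = r *\<^sub>R x + r *\<^sub>R y" "(r + s) *\<^sub>R x = r *\<^sub>R x + s *\<^sub>R x"
    "r *\<^sub>R s *\<^sub>R x = (r * s) *\<^sub>R x" "1 *\<^sub>R x = x"
    by (transfer; simp add: algebra_simps)+
  show "dist x y = norm (x - y)" "sgn x = inverse (norm x) *\<^sub>R x"
    "uniformity = (INF e\<in>{0<..}. principal {(x :: 'a ell2, y). dist x y < e})"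
    by (simp_all add: dist_ell2_def sgn_ell2_def uniformity_ell2_def)
  show "open U \<longleftrightarrow> (\<forall>x\<in>U. \<forall>\<^sub>F (x', y) in uniformity. x' = x \<longrightarrow> y \<in> U)" for U :: "'a ell2 set"
    by (rule open_ell2_def)
  show "norm x = 0 \<longleftrightarrow> x = 0"
  proof
    assume n: "norm x = 0"
    have "norm (ell2_nth x i) \<le> 0" for i
      using L2_set_le_ell2[of "{i}" x] n by simp
    then have "ell2_nth x = (\<lambda>_. 0)" by auto
    then show "x = 0" by transfer
  qed (transfer, simp)
  show "norm (x + y) \<le> norm x + norm y"
  proof (rule norm_ell2_le)
    fix F :: "nat set" assume F: "finite F"
    have "L2_set (\<lambda>i. norm (ell2_nth (x + y) i)) F
        \<le> L2_set (\<lambda>i. norm (ell2_nth x i) + norm (ell2_nth y i)) F"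
      by (rule L2_set_mono) (simp_all add: plus_ell2.rep_eq norm_triangle_ineq)
    also have "\<dots> \<le> L2_set (\<lambda>i. norm (ell2_nth x i)) F + L2_set (\<lambda>i. norm (ell2_nth y i)) F"
      by (rule L2_set_triangle_ineq)
    also have "\<dots> \<le> norm x + norm y" by (intro add_mono L2_set_le_ell2 F)
    finally show "L2_set (\<lambda>i. norm (ell2_nth (x + y) i)) F \<le> norm x + norm y" .
  qed
  show "norm (r *\<^sub>R x) = \<bar>r\<bar> * norm x"
    by transfer (simp add: power_mult_distrib infsum_cmult_right' real_sqrt_mult)
qed

end

lemma norm_ell2_nth_le: "norm (ell2_nth f i) \<le> norm f"
  using L2_set_le_ell2[of "{i}" f] by simp

instance ell2 :: (banach) banach
proof
  fix X :: "nat \<Rightarrow> 'a ell2"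
  assume X: "Cauchy X"
  have coord: "Cauchy (\<lambda>n. ell2_nth (X n) i)" for i
  proof (rule metric_CauchyI)
    fix e :: real assume "e > 0"
    then obtain M where M: "\<And>m n. m \<ge> M \<Longrightarrow> n \<ge> M \<Longrightarrow> dist (X m) (X n) < e"
      using metric_CauchyD[OF X] by blast
    have "dist (ell2_nth (X m) i) (ell2_nth (X n) i) < e" if "m \<ge> M" "n \<ge> M" for m n
      using norm_ell2_nth_le[of "X m - X n" i] M[OF that]
      by (simp add: dist_norm minus_ell2.rep_eq)
    then show "\<exists>M. \<forall>m\<ge>M. \<forall>n\<ge>M. dist (ell2_nth (X m) i) (ell2_nth (X n) i) < e" by blast
  qed
  define l where "l i = lim (\<lambda>n. ell2_nth (X n) i)" for i
  have l: "(\<lambda>n. ell2_nth (X n) i) \<longlonglongrightarrow> l i" for i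
    unfolding l_def using coord[of i] by (simp add: Cauchy_convergent_iff convergent_LIMSEQ_iff)
  have L2_lim: "L2_set (\<lambda>i. norm (ell2_nth (X m) i - l i)) F \<le> e"
    if M: "\<And>n. n \<ge> M \<Longrightarrow> dist (X m) (X n) < e" and F: "finite F" for m M e F
  proof (rule tendsto_upperbound)
    show "(\<lambda>n. L2_set (\<lambda>i. norm (ell2_nth (X m) i - ell2_nth (X n) i)) F)
        \<longlonglongrightarrow> L2_set (\<lambda>i. norm (ell2_nth (X m) i - l i)) F"
      unfolding L2_set_def by (intro tendsto_intros l)
    show "\<forall>\<^sub>F n in sequentially. L2_set (\<lambda>i. norm (ell2_nth (X m) i - ell2_nth (X n) i)) F \<le> e"
      using eventually_ge_at_top[of M]
    proof eventually_elim
      case (elim n)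
      show ?case
        using L2_set_le_ell2[OF F, of "X m - X n"] M[OF elim]
        by (simp add: dist_norm minus_ell2.rep_eq)
    qed
  qed simp
  have diff: "(\<lambda>i. (norm (ell2_nth (X m) i - l i))\<^sup>2) summable_on UNIV"
    if M: "\<And>n. n \<ge> M \<Longrightarrow> dist (X m) (X n) < e" for m M e
  proof (rule nonneg_bdd_above_summable_on)
    show "bdd_above (sum (\<lambda>i. (norm (ell2_nth (X m) i - l i))\<^sup>2) ` {F. F \<subseteq> UNIV \<and> finite F})"
      by (rule bdd_aboveI2[where M = "e\<^sup>2"])
        (use L2_lim[OF M] in \<open>simp add: L2_set_def sqrt_le_D\<close>)
  qed simp
  have "(\<lambda>i. (norm (l i))\<^sup>2) summable_on UNIV"
  proof -
    obtain M where M: "\<And>m n. m \<ge> M \<Longrightarrow> n \<ge> M \<Longrightarrow> dist (X m) (X n) < 1"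
      using metric_CauchyD[OF X, of 1] by auto
    have "(\<lambda>i. (norm (- (ell2_nth (X M) i - l i)))\<^sup>2) summable_on UNIV"
      unfolding norm_minus_cancel by (rule diff[of M M 1]) (use M in simp)
    from sq_summable_add[OF ell2_summable[of "X M"] this] show ?thesis by simp
  qed
  then have nth: "ell2_nth (Abs_ell2 l) = l" by (simp add: Abs_ell2_inverse)
  have "X \<longlonglongrightarrow> Abs_ell2 l"
  proof (rule metric_LIMSEQ_I)
    fix e :: real assume e: "e > 0"
    then obtain M where M: "\<And>m n. m \<ge> M \<Longrightarrow> n \<ge> M \<Longrightarrow> dist (X m) (X n) < e / 2"
      using metric_CauchyD[OF X, of "e / 2"] by auto
    have "dist (X m) (Abs_ell2 l) < e" if "m \<ge> M" for m
    proof -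
      have "norm (X m - Abs_ell2 l) \<le> e / 2"
      proof (rule norm_ell2_le)
        fix F :: "nat set" assume "finite F"
        then show "L2_set (\<lambda>i. norm (ell2_nth (X m - Abs_ell2 l) i)) F \<le> e / 2"
          using L2_lim[of M m "e / 2" F] M[OF that] by (simp add: minus_ell2.rep_eq nth)
      qed
      then show ?thesis using e by (simp add: dist_norm)
    qed
    then show "\<exists>no. \<forall>n\<ge>no. dist (X n) (Abs_ell2 l) < e" by blast
  qed
  then show "convergent X" by (rule convergentI)
qed

definition ell2_structure ::
  "('f::rc_field, 'k::banach) inner_structure \<Rightarrow> ('f, 'k ell2) inner_structure" where
  "ell2_structure K =
    \<lparr>hscale = (\<lambda>c f. Abs_ell2 (\<lambda>i. hscale K c (ell2_nth f i))),
     hinner = (\<lambda>f g. \<Sum>\<^sub>\<infinity>i. hinner K (ell2_nth f i) (ell2_nth g i))\<rparr>"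

lemma hilbert_space_ell2:
  assumes "hilbert_space K"
  shows "hilbert_space (ell2_structure K)"
proof -
  interpret K: hilbert_space K by fact
  interpret V: vector_space "hscale K" by (rule K.vector_space)
  have nth_scale: "ell2_nth (hscale (ell2_structure K) c f) i = hscale K c (ell2_nth f i)" for c f i
    unfolding ell2_structure_def
    by (simp add: Abs_ell2_inverse K.norm_scale power_mult_distrib summable_on_cmult_right
        ell2_summable)
  have inner: "hinner (ell2_structure K) f g = (\<Sum>\<^sub>\<infinity>i. hinner K (ell2_nth f i) (ell2_nth g i))" for f g
    by (simp add: ell2_structure_def)
  have summable: "(\<lambda>i. hinner K (ell2_nth f i) (ell2_nth g i)) summable_on UNIV" for f g
  proof (rule Infinite_Sum.abs_summable_summable, rule Infinite_Sum.abs_summable_on_comparison_test')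
    show "(\<lambda>i. (norm (ell2_nth f i))\<^sup>2 + (norm (ell2_nth g i))\<^sup>2) summable_on UNIV"
      by (intro summable_on_add ell2_summable)
    show "norm (hinner K (ell2_nth f i) (ell2_nth g i))
        \<le> (norm (ell2_nth f i))\<^sup>2 + (norm (ell2_nth g i))\<^sup>2" for i
    proof -
      have "norm (ell2_nth f i) * norm (ell2_nth g i)
          \<le> (norm (ell2_nth f i))\<^sup>2 + (norm (ell2_nth g i))\<^sup>2"
        using sum_squares_bound[of "norm (ell2_nth f i)" "norm (ell2_nth g i)"]
          mult_nonneg_nonneg[OF norm_ge_zero[of "ell2_nth f i"] norm_ge_zero[of "ell2_nth g i"]]
        by linarith
      with K.Cauchy_Schwarz[of "ell2_nth f i" "ell2_nth g i"] show ?thesis by linarith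
    qed
  qed
  show ?thesis
  proof
    fix r :: real and c d :: 'a and x y z :: "'b ell2"
    show "hscale (ell2_structure K) c (x + y)
        = hscale (ell2_structure K) c x + hscale (ell2_structure K) c y"
      "hscale (ell2_structure K) (c + d) x
        = hscale (ell2_structure K) c x + hscale (ell2_structure K) d x"
      "hscale (ell2_structure K) c (hscale (ell2_structure K) d x)
        = hscale (ell2_structure K) (c * d) x"
      "hscale (ell2_structure K) 1 x = x"
      "hscale (ell2_structure K) (of_real r) x = r *\<^sub>R x"
      by (auto simp: ell2_nth_inject[symmetric] fun_eq_iff nth_scale plus_ell2.rep_eq
          scaleR_ell2.rep_eq K.scale_of_real V.scale_right_distrib V.scale_left_distrib)
    show "hinner (ell2_structure K) (x + y) z
        = hinner (ell2_structure K) x z + hinner (ell2_structure K) y z"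
      by (simp add: inner plus_ell2.rep_eq K.inner_add_left infsum_add summable)
    show "hinner (ell2_structure K) (hscale (ell2_structure K) c x) y
        = c * hinner (ell2_structure K) x y"
      by (simp add: inner nth_scale K.inner_scale_left infsum_cmult_right')
    show "hinner (ell2_structure K) y x = conjg (hinner (ell2_structure K) x y)"
      unfolding inner
      using has_sum_bounded_linear[OF bounded_linear_conjg has_sum_infsum[OF summable[of x y]]]
      by (intro infsumI) (simp flip: K.inner_conjg)
    show "hinner (ell2_structure K) x x = of_real ((norm x)\<^sup>2)"
    proof -
      have "(norm x)\<^sup>2 = (\<Sum>\<^sub>\<infinity>i. (norm (ell2_nth x i))\<^sup>2)"
        unfolding norm_ell2.rep_eq by (simp add: infsum_nonneg)
      then show ?thesis
        unfolding inner K.inner_self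
        by (metis infsumI has_sum_of_real has_sum_infsum[OF ell2_summable])
    qed
  qed
qed


section \<open>Operator-valued Bessel and frame sequences\<close>

definition bessel_sequence ::
  "('f, 'h::real_normed_vector) inner_structure \<Rightarrow> ('f, 'k::real_normed_vector) inner_structure
    \<Rightarrow> nat set \<Rightarrow> (nat \<Rightarrow> 'h \<Rightarrow> 'k) \<Rightarrow> bool" where
  "bessel_sequence H K I A \<longleftrightarrow>
     (\<forall>i\<in>I. bounded_operator H K (A i)) \<and>
     (\<exists>\<beta>>0. \<forall>x. (\<lambda>i. (norm (A i x))\<^sup>2) summable_on I \<and>
                 (\<Sum>\<^sub>\<infinity>i\<in>I. (norm (A i x))\<^sup>2) \<le> \<beta> * (norm x)\<^sup>2)"

definition range_space ::
  "('f::rc_field, 'h::banach) inner_structure \<Rightarrow> ('f, 'k) inner_structure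
    \<Rightarrow> nat set \<Rightarrow> (nat \<Rightarrow> 'h \<Rightarrow> 'k) \<Rightarrow> 'h set" where
  "range_space H K I A = closure (module.span (hscale H) (\<Union>i\<in>I. range (adj H K (A i))))"

definition analysis_op :: "nat set \<Rightarrow> (nat \<Rightarrow> 'h \<Rightarrow> 'k::real_normed_vector) \<Rightarrow> 'h \<Rightarrow> 'k ell2" where
  "analysis_op I A x = Abs_ell2 (\<lambda>i. if i \<in> I then A i x else 0)"

definition frame_op ::
  "('f::rc_field, 'h) inner_structure \<Rightarrow> ('f, 'k::banach) inner_structure
    \<Rightarrow> nat set \<Rightarrow> (nat \<Rightarrow> 'h \<Rightarrow> 'k) \<Rightarrow> 'h \<Rightarrow> 'h" where
  "frame_op H K I A = adj H (ell2_structure K) (analysis_op I A) \<circ> analysis_op I A"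

definition frame_sequence_bounds ::
  "('f::rc_field, 'h::banach) inner_structure \<Rightarrow> ('f, 'k::banach) inner_structure
    \<Rightarrow> nat set \<Rightarrow> (nat \<Rightarrow> 'h \<Rightarrow> 'k) \<Rightarrow> real \<Rightarrow> real \<Rightarrow> bool" where
  "frame_sequence_bounds H K I A \<alpha> \<beta> \<longleftrightarrow>
     0 < \<alpha> \<and> 0 < \<beta> \<and>
     (\<forall>i\<in>I. bounded_operator H K (A i)) \<and>
     (\<forall>x\<in>range_space H K I A.
        (\<lambda>i. (norm (A i x))\<^sup>2) summable_on I \<and>
        \<alpha> * (norm x)\<^sup>2 \<le> (\<Sum>\<^sub>\<infinity>i\<in>I. (norm (A i x))\<^sup>2) \<and>
        (\<Sum>\<^sub>\<infinity>i\<in>I. (norm (A i x))\<^sup>2) \<le> \<beta> * (norm x)\<^sup>2)"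

definition frame_sequence ::
  "('f::rc_field, 'h::banach) inner_structure \<Rightarrow> ('f, 'k::banach) inner_structure
    \<Rightarrow> nat set \<Rightarrow> (nat \<Rightarrow> 'h \<Rightarrow> 'k) \<Rightarrow> bool" where
  "frame_sequence H K I A \<longleftrightarrow> (\<exists>\<alpha> \<beta>. frame_sequence_bounds H K I A \<alpha> \<beta>)"

definition canonical_dual ::
  "('f::rc_field, 'h::banach) inner_structure \<Rightarrow> ('f, 'k::banach) inner_structure
    \<Rightarrow> nat set \<Rightarrow> (nat \<Rightarrow> 'h \<Rightarrow> 'k) \<Rightarrow> nat \<Rightarrow> 'h \<Rightarrow> 'k" where
  "canonical_dual H K I A i =
     A i \<circ> inv_into (range_space H K I A) (frame_op H K I A) \<circ> orth_proj H (range_space H K I A)"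

definition perturbation ::
  "('f, 'h::real_normed_vector) inner_structure \<Rightarrow> ('f, 'k::real_normed_vector) inner_structure
    \<Rightarrow> nat set \<Rightarrow> real \<Rightarrow> (nat \<Rightarrow> 'h \<Rightarrow> 'k) \<Rightarrow> (nat \<Rightarrow> 'h \<Rightarrow> 'k) \<Rightarrow> bool" where
  "perturbation H K I \<mu> A B \<longleftrightarrow>
     bessel_sequence H K I A \<and> bessel_sequence H K I B \<and>
     onorm (\<lambda>x. analysis_op I A x - analysis_op I B x) \<le> \<mu>"

end

theory Submission
  imports Defs
begin

text \<open>
  Let \<open>X\<close>, \<open>Y\<close> be the analysis operators, \<open>V\<close>, \<open>W\<close> the range spaces, \<open>P\<close>, \<open>Q\<close> the projections onto
  them, \<open>a = sqrt \<alpha>\<close> and \<open>b = a - \<mu>\<close>. Each operator vanishes on the complement of its range space, and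
  \<open>b \<parallel>x\<parallel> \<le> \<parallel>Y x\<parallel>\<close> for \<open>x \<in> V\<close>. Since the gap is less than \<open>1\<close>, \<open>Q\<close> maps \<open>V\<close> onto \<open>W\<close>, so the bound
  carries over to \<open>W\<close>. For the duals \<open>X\<^sup>\<sim>\<close> and \<open>Y\<^sup>\<sim>\<close>, the operator \<open>Y\<^sup>\<sim> Y*\<close> is the orthogonal projection
  onto the range of \<open>Y\<close>, and \<open>X* X\<^sup>\<sim> = P\<close>. Hence
  \<open>X\<^sup>\<sim> - Y\<^sup>\<sim> = (1 - Y\<^sup>\<sim> Y*) X\<^sup>\<sim> + Y\<^sup>\<sim> (Y* - X*) X\<^sup>\<sim> - Y\<^sup>\<sim> (1 - P)\<close>. Because \<open>X\<^sup>\<sim> h = X u\<close> with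
  \<open>\<parallel>u\<parallel> \<le> \<parallel>h\<parallel> / a\<^sup>2\<close>, the first term is at most \<open>\<parallel>X u - Y u\<parallel> \<le> \<mu> \<parallel>h\<parallel> / a\<^sup>2\<close>; the others are bounded by
  \<open>\<mu> \<parallel>h\<parallel> / (a b)\<close> and \<open>\<parallel>Q (1 - P)\<parallel> \<parallel>h\<parallel> / b \<le> \<Delta> \<parallel>h\<parallel> / b\<close>. The sum is below the claimed bound.
\<close>

section \<open>Hilbert space geometry\<close>

definition orth_compl :: "('f::zero, 'h) inner_structure \<Rightarrow> 'h set \<Rightarrow> 'h set" where
  "orth_compl H V = {x. \<forall>v\<in>V. hinner H x v = 0}"

lemma orth_complI: "(\<And>v. v \<in> V \<Longrightarrow> hinner H x v = 0) \<Longrightarrow> x \<in> orth_compl H V"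
  by (simp add: orth_compl_def)

lemma orth_complD: "x \<in> orth_compl H V \<Longrightarrow> v \<in> V \<Longrightarrow> hinner H x v = 0"
  by (simp add: orth_compl_def)

context hilbert_space
begin

sublocale VS: vector_space "hscale H"
  by (rule vector_space)

lemma inner_zero_left [simp]: "hinner H 0 y = 0"
  using inner_add_left[of 0 0 y] by simp

lemma inner_zero_right [simp]: "hinner H x 0 = 0"
  using inner_add_right[of x 0 0] by simp

lemma inner_diff_left: "hinner H (x - y) z = hinner H x z - hinner H y z"
  using inner_add_left[of "x - y" y z] by simp

lemma inner_diff_right: "hinner H x (y - z) = hinner H x y - hinner H x z"
  using inner_add_right[of x "y - z" z] by simp

lemma inner_commute_zero: "hinner H x y = 0 \<Longrightarrow> hinner H y x = 0"
  using inner_conjg[of y x] norm_conjg[of "0::'f"] by simp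

lemma inner_self_eq_zero [simp]: "hinner H x x = 0 \<longleftrightarrow> x = 0"
  by (simp add: inner_self)

lemma norm_inner_self: "norm (hinner H x x) = (norm x)\<^sup>2"
  by (simp only: inner_self norm_of_real abs_power2)

lemma eq_if_inner_eq:
  assumes "\<And>z. hinner H z x = hinner H z y"
  shows "x = y"
proof -
  have "hinner H (x - y) (x - y) = 0" using assms by (simp add: inner_diff_right)
  then show ?thesis by simp
qed

lemma norm_le_if_inner_le:
  assumes "\<And>x. norm (hinner H x y) \<le> M * norm x" and "0 \<le> M"
  shows "norm y \<le> M"
proof (cases "y = 0")
  case False
  have "norm y * norm y \<le> M * norm y"
    using assms(1)[of y] by (simp add: norm_inner_self power2_eq_square)
  then show ?thesis using False by simp
qed (use \<open>0 \<le> M\<close> in simp)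

lemma bounded_linear_inner_left: "bounded_linear (\<lambda>x. hinner H x y)"
proof (rule bounded_linear_intro[where K = "norm y"])
  show "hinner H (r *\<^sub>R x) y = r *\<^sub>R hinner H x y" for r x
    by (simp add: scale_of_real[symmetric] inner_scale_left scaleR_conv_of_real)
qed (simp_all add: inner_add_left Cauchy_Schwarz)

lemma bounded_linear_scale: "bounded_linear (hscale H c)"
proof (rule bounded_linear_intro[where K = "norm c"])
  show "hscale H c (r *\<^sub>R x) = r *\<^sub>R hscale H c x" for r x
    by (simp add: scale_of_real[symmetric] VS.scale_scale mult.commute)
qed (simp_all add: VS.scale_right_distrib norm_scale mult.commute)

lemma pythagorean:
  assumes "hinner H x y = 0"
  shows "(norm (x + y))\<^sup>2 = (norm x)\<^sup>2 + (norm y)\<^sup>2"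
proof -
  have "of_real ((norm (x + y))\<^sup>2) = (of_real ((norm x)\<^sup>2 + (norm y)\<^sup>2) :: 'f)"
    by (simp only: inner_self[symmetric] of_real_add inner_add_left inner_add_right assms
        inner_commute_zero[OF assms]) simp
  then show ?thesis by (simp only: of_real_eq_iff)
qed

lemma parallelogram_law:
  "(norm (x + y))\<^sup>2 + (norm (x - y))\<^sup>2 = 2 * (norm x)\<^sup>2 + 2 * (norm (y :: 'h))\<^sup>2"
proof -
  have "hinner H (x + y) (x + y) + hinner H (x - y) (x - y)
      = (hinner H x x + hinner H x x) + (hinner H y y + hinner H y y)"
    by (simp only: inner_add_left inner_add_right inner_diff_left inner_diff_right)
      (simp add: algebra_simps)
  then have "(norm (x + y))\<^sup>2 + (norm (x - y))\<^sup>2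
      = ((norm x)\<^sup>2 + (norm x)\<^sup>2) + ((norm y)\<^sup>2 + (norm y)\<^sup>2)"
    by (simp only: inner_self of_real_add[symmetric] of_real_eq_iff)
  then show ?thesis by simp
qed

lemma dist_sq_le_if_nearly_nearest:
  fixes C :: "'h set"
  assumes "convex C" and v: "v \<in> C" and w: "w \<in> C"
  shows "(dist v w)\<^sup>2
    \<le> 2 * ((dist x v)\<^sup>2 - (infdist x C)\<^sup>2) + 2 * ((dist x w)\<^sup>2 - (infdist x C)\<^sup>2)"
proof -
  define m where "m = (1/2) *\<^sub>R v + (1/2) *\<^sub>R w"
  have "m \<in> C" unfolding m_def by (rule convexD[OF assms]) auto
  then have "(infdist x C)\<^sup>2 \<le> (dist x m)\<^sup>2"
    by (intro power_mono infdist_le infdist_nonneg)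
  moreover have "(x - v) + (x - w) = 2 *\<^sub>R (x - m)"
    by (simp add: m_def algebra_simps scaleR_2)
  then have "4 * (dist x m)\<^sup>2 + (dist v w)\<^sup>2 = 2 * (dist x v)\<^sup>2 + 2 * (dist x w)\<^sup>2"
    using parallelogram_law[of "x - v" "x - w"]
    by (simp add: dist_norm power_mult_distrib norm_minus_commute)
  ultimately show ?thesis by simp
qed

lemma nearest_point_exists:
  fixes C :: "'h set"
  assumes "closed C" "convex C" "C \<noteq> {}"
  obtains p where "p \<in> C" "dist x p = infdist x C"
proof -
  have "infdist x C \<in> closure (dist x ` C)"
    using assms(3) by (simp add: infdist_notempty closure_contains_Inf)
  then obtain d where "\<And>n. d n \<in> dist x ` C" and d: "d \<longlonglongrightarrow> infdist x C"
    unfolding closure_sequential by blast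
  then obtain f where f: "\<And>n. f n \<in> C" and dist_f: "\<And>n. d n = dist x (f n)"
    unfolding image_iff by metis
  have lim: "(\<lambda>n. dist x (f n)) \<longlonglongrightarrow> infdist x C" using d by (simp flip: dist_f)
  have "Cauchy f"
  proof (rule metric_CauchyI)
    fix e :: real assume e: "0 < e"
    have "(\<lambda>n. (dist x (f n))\<^sup>2 - (infdist x C)\<^sup>2) \<longlonglongrightarrow> (infdist x C)\<^sup>2 - (infdist x C)\<^sup>2"
      by (intro tendsto_intros lim)
    then have "\<forall>\<^sub>F n in sequentially. (dist x (f n))\<^sup>2 - (infdist x C)\<^sup>2 < e\<^sup>2 / 4"
      using e by (intro order_tendstoD(2)) auto
    then obtain N where N: "\<And>n. n \<ge> N \<Longrightarrow> (dist x (f n))\<^sup>2 - (infdist x C)\<^sup>2 < e\<^sup>2 / 4"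
      unfolding eventually_sequentially by blast
    have "dist (f m) (f n) < e" if "m \<ge> N" "n \<ge> N" for m n
    proof -
      have "(dist (f m) (f n))\<^sup>2 \<le> 2 * ((dist x (f m))\<^sup>2 - (infdist x C)\<^sup>2)
          + 2 * ((dist x (f n))\<^sup>2 - (infdist x C)\<^sup>2)"
        by (rule dist_sq_le_if_nearly_nearest[OF assms(2) f f])
      also have "\<dots> < 2 * (e\<^sup>2 / 4) + 2 * (e\<^sup>2 / 4)"
        by (intro add_strict_mono mult_strict_left_mono N that) simp_all
      finally have "(dist (f m) (f n))\<^sup>2 < e\<^sup>2" by simp
      then show ?thesis using e by (simp add: power2_less_imp_less)
    qed
    then show "\<exists>N. \<forall>m\<ge>N. \<forall>n\<ge>N. dist (f m) (f n) < e" by blast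
  qed
  then obtain p where p: "f \<longlonglongrightarrow> p" by (auto simp: Cauchy_convergent_iff convergent_def)
  then have "(\<lambda>n. dist x (f n)) \<longlonglongrightarrow> dist x p" by (intro tendsto_intros)
  then have "dist x p = infdist x C" using lim by (rule LIMSEQ_unique)
  moreover have "p \<in> C" using closed_sequentially[OF assms(1)] f p by blast
  ultimately show thesis using that by blast
qed

lemma inner_eq_zero_if_norm_minimal:
  assumes "\<And>c. norm x \<le> norm (x - hscale H c v)"
  shows "hinner H x v = 0"
proof (cases "v = 0")
  case False
  define c where "c = hinner H x v / of_real ((norm v)\<^sup>2)"
  have "hinner H (x - hscale H c v) v = 0"
    using False by (simp add: inner_diff_left inner_scale_left inner_self c_def)
  then have "hinner H (x - hscale H c v) (hscale H c v) = 0"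
    by (simp add: inner_scale_right)
  from pythagorean[OF this] have "(norm x)\<^sup>2 = (norm (x - hscale H c v))\<^sup>2 + (norm (hscale H c v))\<^sup>2"
    by simp
  moreover have "(norm x)\<^sup>2 \<le> (norm (x - hscale H c v))\<^sup>2"
    using assms by (intro power_mono) auto
  ultimately have "(norm (hscale H c v))\<^sup>2 \<le> 0" by linarith
  then have "norm c * norm v = 0" by (simp add: norm_scale)
  then show ?thesis using False by (simp add: c_def)
qed simp

lemma subspace_orth_compl: "VS.subspace (orth_compl H V)"
  by (rule VS.subspaceI) (simp_all add: orth_compl_def inner_add_left inner_scale_left)

lemma subspace_closure:
  assumes "VS.subspace V"
  shows "VS.subspace (closure V)"
proof (rule VS.subspaceI)
  show "0 \<in> closure V" using VS.subspace_0[OF assms] closure_subset by blast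
next
  fix x y assume "x \<in> closure V" "y \<in> closure V"
  then obtain f g where "\<And>n. f n \<in> V" "f \<longlonglongrightarrow> x" "\<And>n. g n \<in> V" "g \<longlonglongrightarrow> y"
    unfolding closure_sequential by blast
  then have "(\<lambda>n. f n + g n) \<longlonglongrightarrow> x + y" "\<And>n. f n + g n \<in> V"
    using assms by (auto intro: tendsto_add VS.subspace_add)
  then show "x + y \<in> closure V"
    unfolding closure_sequential by (intro exI[of _ "\<lambda>n. f n + g n"]) blast
next
  fix c x assume "x \<in> closure V"
  then have "hscale H c x \<in> closure (hscale H c ` V)"
    using closure_bounded_linear_image_subset[OF bounded_linear_scale] by blast
  moreover have "hscale H c ` V \<subseteq> V" using assms by (auto intro: VS.subspace_scale)
  ultimately show "hscale H c x \<in> closure V" using closure_mono by blast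
qed

end

section \<open>Orthogonal projections\<close>

locale closed_subspace = hilbert_space H
  for H :: "('f::rc_field, 'h::banach) inner_structure" +
  fixes V :: "'h set"
  assumes closed: "closed V" and subspace: "VS.subspace V"
begin

lemma zero_in: "0 \<in> V"
  by (rule VS.subspace_0[OF subspace])

lemma real_subspace: "Real_Vector_Spaces.subspace V"
  using zero_in VS.subspace_add[OF subspace] VS.subspace_scale[OF subspace]
  by (metis scale_of_real real_vector.subspaceI)

lemma orth_proj_eqI:
  assumes p: "p \<in> V" "x - p \<in> orth_compl H V"
  shows "orth_proj H V x = p"
  unfolding orth_proj_def
proof (rule the_equality)
  fix q assume q: "q \<in> V \<and> (\<forall>v\<in>V. hinner H (x - q) v = 0)"
  have "x - p - (x - q) \<in> orth_compl H V"
    using q by (intro VS.subspace_diff[OF subspace_orth_compl p(2)]) (simp add: orth_complI)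
  moreover have "q - p \<in> V" using p q by (simp add: VS.subspace_diff[OF subspace])
  ultimately have "hinner H (q - p) (q - p) = 0" by (simp add: orth_complD)
  then show "q = p" by simp
qed (use p in \<open>auto dest: orth_complD\<close>)

lemma orthogonal_decomposition:
  obtains p where "p \<in> V" "x - p \<in> orth_compl H V"
proof -
  obtain p where p: "p \<in> V" "dist x p = infdist x V"
    using nearest_point_exists closed subspace_imp_convex[OF real_subspace]
      zero_in by blast
  have "hinner H (x - p) v = 0" if "v \<in> V" for v
  proof (rule inner_eq_zero_if_norm_minimal)
    fix c
    have "p + hscale H c v \<in> V"
      using p(1) that by (intro VS.subspace_add[OF subspace] VS.subspace_scale[OF subspace])
    then show "norm (x - p) \<le> norm (x - p - hscale H c v)"
      using infdist_le p(2) by (fastforce simp: dist_norm algebra_simps)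
  qed
  with p(1) that show thesis by (blast intro: orth_complI)
qed

lemma orth_proj_in: "orth_proj H V x \<in> V"
  and diff_orth_proj_in: "x - orth_proj H V x \<in> orth_compl H V"
proof -
  obtain p where "p \<in> V" "x - p \<in> orth_compl H V" by (rule orthogonal_decomposition)
  with orth_proj_eqI show "orth_proj H V x \<in> V" "x - orth_proj H V x \<in> orth_compl H V" by auto
qed

lemma orth_proj_id: "x \<in> V \<Longrightarrow> orth_proj H V x = x"
  by (rule orth_proj_eqI) (simp_all add: VS.subspace_0[OF subspace_orth_compl])

lemma orth_proj_orth_compl: "x \<in> orth_compl H V \<Longrightarrow> orth_proj H V x = 0"
  by (intro orth_proj_eqI zero_in) simp

lemma inner_orth_proj: "hinner H (orth_proj H V x) y = hinner H x (orth_proj H V y)"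
proof -
  have "hinner H (x - orth_proj H V x) (orth_proj H V y) = 0"
    by (rule orth_complD[OF diff_orth_proj_in orth_proj_in])
  moreover have "hinner H (orth_proj H V x) (y - orth_proj H V y) = 0"
    by (rule inner_commute_zero[OF orth_complD[OF diff_orth_proj_in orth_proj_in]])
  ultimately show ?thesis by (simp add: inner_diff_left inner_diff_right)
qed

lemma norm_orth_proj_sq:
  "(norm x)\<^sup>2 = (norm (x - orth_proj H V x))\<^sup>2 + (norm (orth_proj H V x))\<^sup>2"
  using pythagorean[OF orth_complD[OF diff_orth_proj_in orth_proj_in], of x x] by simp

lemma norm_orth_proj_le: "norm (orth_proj H V x) \<le> norm x"
  and norm_diff_orth_proj_le: "norm (x - orth_proj H V x) \<le> norm x"
  by (rule power2_le_imp_le; simp add: norm_orth_proj_sq[of x])+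

lemma bounded_operator_orth_proj: "bounded_operator H H (orth_proj H V)"
proof -
  have add: "orth_proj H V (x + y) = orth_proj H V x + orth_proj H V y" for x y
  proof (rule orth_proj_eqI)
    have "(x - orth_proj H V x) + (y - orth_proj H V y) \<in> orth_compl H V"
      by (intro VS.subspace_add[OF subspace_orth_compl] diff_orth_proj_in)
    then show "x + y - (orth_proj H V x + orth_proj H V y) \<in> orth_compl H V"
      by (simp add: algebra_simps)
  qed (intro VS.subspace_add[OF subspace] orth_proj_in)
  have scale: "orth_proj H V (hscale H c x) = hscale H c (orth_proj H V x)" for c x
  proof (rule orth_proj_eqI)
    have "hscale H c (x - orth_proj H V x) \<in> orth_compl H V"
      by (intro VS.subspace_scale[OF subspace_orth_compl] diff_orth_proj_in)
    then show "hscale H c x - hscale H c (orth_proj H V x) \<in> orth_compl H V"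
      by (simp add: VS.scale_right_diff_distrib)
  qed (intro VS.subspace_scale[OF subspace] orth_proj_in)
  have "bounded_linear (orth_proj H V)"
    using add scale norm_orth_proj_le
    by (intro bounded_linear_intro[where K = 1]) (simp_all flip: scale_of_real)
  with scale show ?thesis by (simp add: bounded_operator_def)
qed

lemma eq_if_no_orthogonal_vector:
  assumes U: "VS.subspace U" and "V \<subseteq> U" and no_orth: "U \<inter> orth_compl H V \<subseteq> {0}"
  shows "V = U"
proof
  show "U \<subseteq> V"
  proof
    fix x assume "x \<in> U"
    then have "x - orth_proj H V x \<in> U"
      using \<open>V \<subseteq> U\<close> orth_proj_in by (intro VS.subspace_diff[OF U]) auto
    with diff_orth_proj_in no_orth have "x - orth_proj H V x = 0" by blast
    then show "x \<in> V" using orth_proj_in[of x] by simp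
  qed
qed (rule \<open>V \<subseteq> U\<close>)

lemma delta_upper:
  assumes "x \<in> W"
  shows "norm (x - orth_proj H V x) / norm x \<le> delta H W V"
proof -
  have "bdd_above ((\<lambda>y. norm (y - orth_proj H V y) / norm y) ` W)"
    using norm_diff_orth_proj_le by (intro bdd_aboveI2[where M = 1]) (simp add: divide_le_eq)
  then show ?thesis
    unfolding delta_def onorm_on_def using assms by (rule cSUP_upper[rotated])
qed

lemma norm_diff_orth_proj_le_delta:
  assumes "x \<in> W"
  shows "norm (x - orth_proj H V x) \<le> delta H W V * norm x"
proof (cases "x = 0")
  case True
  then show ?thesis using norm_diff_orth_proj_le[of x] by simp
next
  case False
  then show ?thesis using delta_upper[OF assms] by (simp add: divide_le_eq)
qed

lemma delta_nonneg:
  assumes "0 \<in> W"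
  shows "0 \<le> delta H W V"
  using delta_upper[OF assms] by simp

lemma gap_nonneg:
  assumes "0 \<in> W"
  shows "0 \<le> gap H W V"
  using delta_nonneg[OF assms] by (simp add: gap_def le_max_iff_disj)

lemma norm_orth_proj_diff_orth_proj_le:
  assumes "closed_subspace H W"
  shows "norm (orth_proj H W (h - orth_proj H V h)) \<le> delta H W V * norm h"
proof (rule norm_le_if_inner_le)
  interpret W: closed_subspace H W by fact
  show "0 \<le> delta H W V * norm h"
    by (intro mult_nonneg_nonneg delta_nonneg W.zero_in norm_ge_zero)
  fix x
  let ?y = "orth_proj H W x"
  have "norm (hinner H x (orth_proj H W (h - orth_proj H V h)))
      = norm (hinner H (?y - orth_proj H V ?y) h)"
    by (simp add: W.inner_orth_proj[symmetric] inner_orth_proj inner_diff_left inner_diff_right)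
  also have "\<dots> \<le> norm (?y - orth_proj H V ?y) * norm h" by (rule Cauchy_Schwarz)
  also have "\<dots> \<le> delta H W V * norm ?y * norm h"
    by (intro mult_right_mono norm_diff_orth_proj_le_delta W.orth_proj_in norm_ge_zero)
  also have "\<dots> \<le> delta H W V * norm x * norm h"
    by (intro mult_right_mono mult_left_mono W.norm_orth_proj_le norm_ge_zero delta_nonneg
        W.zero_in)
  finally show "norm (hinner H x (orth_proj H W (h - orth_proj H V h)))
      \<le> delta H W V * norm h * norm x" by (simp add: mult_ac)
qed

end

section \<open>Bounded operators and adjoints\<close>

lemma (in hilbert_space) riesz_representation:
  assumes "bounded_linear \<phi>" and scale: "\<And>c x. \<phi> (hscale H c x) = c * \<phi> x"
  obtains y where "\<And>x. \<phi> x = hinner H x y"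
proof (cases "\<forall>x. \<phi> x = 0")
  case True
  then show thesis using that[of 0] by simp
next
  case False
  then obtain x\<^sub>0 where x\<^sub>0: "\<phi> x\<^sub>0 \<noteq> 0" by blast
  interpret \<phi>: bounded_linear \<phi> by fact
  define N where "N = {x. \<phi> x = 0}"
  interpret N: closed_subspace H N
    by unfold_locales (auto intro!: closed_Collect_eq \<phi>.continuous_on VS.subspaceI
        continuous_intros simp: N_def \<phi>.zero \<phi>.add scale)
  define r where "r = x\<^sub>0 - orth_proj H N x\<^sub>0"
  have "\<phi> r = \<phi> x\<^sub>0" using N.orth_proj_in[of x\<^sub>0] by (simp add: r_def \<phi>.diff N_def)
  with x\<^sub>0 have \<phi>r: "\<phi> r \<noteq> 0" by simp
  then have "r \<noteq> 0" using \<phi>.zero by auto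
  have "\<phi> x = hinner H x (hscale H (conjg (\<phi> r / of_real ((norm r)\<^sup>2))) r)" for x
  proof -
    have "x - hscale H (\<phi> x / \<phi> r) r \<in> N" using \<phi>r by (simp add: N_def \<phi>.diff scale)
    then have "hinner H r (x - hscale H (\<phi> x / \<phi> r) r) = 0"
      unfolding r_def by (rule orth_complD[OF N.diff_orth_proj_in])
    from inner_commute_zero[OF this] have "hinner H x r = \<phi> x / \<phi> r * of_real ((norm r)\<^sup>2)"
      by (simp only: inner_diff_left inner_scale_left inner_self) simp
    then show ?thesis using \<phi>r \<open>r \<noteq> 0\<close> by (simp add: inner_scale_right conjg_conjg)
  qed
  then show thesis by (rule that)
qed

locale hilbert_operator = H: hilbert_space H + K: hilbert_space K
  for H :: "('f::rc_field, 'h::banach) inner_structure"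
    and K :: "('f, 'k::banach) inner_structure" +
  fixes T :: "'h \<Rightarrow> 'k"
  assumes bounded_operator: "bounded_operator H K T"
begin

sublocale bounded_linear T
  using bounded_operator by (simp add: bounded_operator_def)

lemma apply_scale: "T (hscale H c x) = hscale K c (T x)"
  using bounded_operator by (simp add: bounded_operator_def)

lemma inner_adj: "hinner H x (adj H K T y) = hinner K (T x) y"
proof -
  have "\<exists>z. \<forall>x. hinner K (T x) y = hinner H x z" for y
    by (rule H.riesz_representation[of "\<lambda>x. hinner K (T x) y"])
      (auto simp: apply_scale K.inner_scale_left
        intro: bounded_linear_compose[OF K.bounded_linear_inner_left bounded_linear_axioms])
  then obtain S where S: "\<And>x y. hinner K (T x) y = hinner H x (S y)" by metis
  have "\<forall>x y. hinner K (T x) y = hinner H x (adj H K T y)"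
    unfolding adj_def
  proof (rule theI[of _ S])
    fix S' assume "\<forall>x y. hinner K (T x) y = hinner H x (S' y)"
    then show "S' = S" by (intro ext H.eq_if_inner_eq) (simp flip: S)
  qed (simp add: S)
  then show ?thesis by simp
qed

lemma norm_adj_le:
  assumes bound: "\<And>x. norm (T x) \<le> M * norm x" and "0 \<le> M"
  shows "norm (adj H K T y) \<le> M * norm y"
proof (rule H.norm_le_if_inner_le)
  fix x
  have "norm (hinner H x (adj H K T y)) \<le> norm (T x) * norm y"
    unfolding inner_adj by (rule K.Cauchy_Schwarz)
  also have "\<dots> \<le> M * norm x * norm y" by (intro mult_right_mono bound norm_ge_zero)
  finally show "norm (hinner H x (adj H K T y)) \<le> M * norm y * norm x" by (simp add: mult_ac)
qed (simp add: \<open>0 \<le> M\<close>)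

lemma bounded_operator_adj: "bounded_operator K H (adj H K T)"
proof -
  have add: "adj H K T (x + y) = adj H K T x + adj H K T y" for x y
    by (rule H.eq_if_inner_eq) (simp add: inner_adj K.inner_add_right H.inner_add_right)
  have scale: "adj H K T (hscale K c x) = hscale H c (adj H K T x)" for c x
    by (rule H.eq_if_inner_eq) (simp add: inner_adj K.inner_scale_right H.inner_scale_right)
  obtain M where "0 < M" "\<And>x. norm (T x) \<le> norm x * M" using pos_bounded by blast
  then have "norm (adj H K T x) \<le> M * norm x" for x
    by (intro norm_adj_le) (simp_all add: mult.commute)
  with add scale have "bounded_linear (adj H K T)"
    by (intro bounded_linear_intro[where K = M])
      (simp_all add: mult.commute flip: H.scale_of_real K.scale_of_real)
  with scale show ?thesis by (simp add: bounded_operator_def)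
qed

lemma hilbert_operator_adj: "hilbert_operator K H (adj H K T)"
  by unfold_locales (rule bounded_operator_adj)

lemma hilbert_operator_diff:
  assumes "hilbert_operator H K S"
  shows "hilbert_operator H K (\<lambda>x. T x - S x)"
proof
  interpret S: hilbert_operator H K S by fact
  show "bounded_operator H K (\<lambda>x. T x - S x)"
    using bounded_linear_sub[OF bounded_linear_axioms S.bounded_linear_axioms]
    by (simp add: bounded_operator_def apply_scale S.apply_scale
        K.VS.scale_right_diff_distrib)
qed

lemma adj_operator_diff:
  assumes "hilbert_operator H K S"
  shows "adj H K (\<lambda>x. T x - S x) y = adj H K T y - adj H K S y"
proof -
  interpret S: hilbert_operator H K S by fact
  interpret D: hilbert_operator H K "\<lambda>x. T x - S x"
    by (rule hilbert_operator_diff[OF assms])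
  show ?thesis
    by (rule H.eq_if_inner_eq)
      (simp add: inner_adj S.inner_adj D.inner_adj K.inner_diff_left H.inner_diff_right)
qed

lemma closed_subspace_image:
  assumes "closed_subspace H V"
    and "0 < c" and lower_bound: "\<And>x. x \<in> V \<Longrightarrow> c * norm x \<le> norm (T x)"
  shows "closed_subspace K (T ` V)"
proof
  interpret V: closed_subspace H V by fact
  interpret module_hom "hscale H" "hscale K" T
    by unfold_locales (simp_all add: add apply_scale)
  show "K.VS.subspace (T ` V)" by (rule subspace_image[OF V.subspace])
  show "closed (T ` V)"
    using complete_isometric_image[OF \<open>0 < c\<close> V.real_subspace bounded_linear_axioms] lower_bound
      V.closed by (simp add: complete_eq_closed)
qed

end

lemma hilbert_operator_compose:
  assumes "hilbert_operator H K T" "hilbert_operator K L S"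
  shows "hilbert_operator H L (S \<circ> T)"
proof -
  interpret T: hilbert_operator H K T by fact
  interpret S: hilbert_operator K L S by fact
  have "bounded_linear (S \<circ> T)"
    unfolding comp_def
    by (rule bounded_linear_compose[OF S.bounded_linear_axioms T.bounded_linear_axioms])
  then show ?thesis
    by unfold_locales (simp add: bounded_operator_def T.apply_scale S.apply_scale)
qed

lemma (in closed_subspace) image_orth_proj_if_gap_less_1:
  assumes "closed_subspace H W" and "gap H V W < 1"
  shows "orth_proj H W ` V = W"
proof -
  interpret W: closed_subspace H W by fact
  interpret Q: hilbert_operator H H "orth_proj H W"
    by unfold_locales (rule W.bounded_operator_orth_proj)
  have delta: "delta H V W < 1" "delta H W V < 1" using assms(2) by (simp_all add: gap_def)
  have "(1 - delta H V W) * norm v \<le> norm (orth_proj H W v)" if "v \<in> V" for v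
    using W.norm_diff_orth_proj_le_delta[OF that] norm_triangle_ineq2[of v "v - orth_proj H W v"]
    by (simp add: algebra_simps)
  with delta interpret QV: closed_subspace H "orth_proj H W ` V"
    by (intro Q.closed_subspace_image[where c = "1 - delta H V W"] closed_subspace_axioms) auto
  show ?thesis
  proof (rule QV.eq_if_no_orthogonal_vector[OF W.subspace])
    show "W \<inter> orth_compl H (orth_proj H W ` V) \<subseteq> {0}"
    proof
      fix w assume "w \<in> W \<inter> orth_compl H (orth_proj H W ` V)"
      then have w: "w \<in> W" "w \<in> orth_compl H (orth_proj H W ` V)" by auto
      have "hinner H w v = 0" if "v \<in> V" for v
        using orth_complD[OF w(2), of "orth_proj H W v"] that
        by (simp add: W.inner_orth_proj[symmetric] W.orth_proj_id[OF w(1)])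
      then have "orth_proj H V w = 0" by (intro orth_proj_orth_compl orth_complI)
      then have "norm w \<le> delta H W V * norm w"
        using norm_diff_orth_proj_le_delta[OF w(1)] by simp
      with delta show "w \<in> {0}" by (simp add: mult_le_cancel_right1)
    qed
  qed (use W.orth_proj_in in blast)
qed

section \<open>Operators bounded below and their canonical duals\<close>

definition canonical_dual_op ::
  "('f::zero, 'h::minus) inner_structure \<Rightarrow> ('f, 'k) inner_structure \<Rightarrow> ('h \<Rightarrow> 'k) \<Rightarrow> 'h set
    \<Rightarrow> 'h \<Rightarrow> 'k" where
  "canonical_dual_op H K T V = T \<circ> inv_into V (adj H K T \<circ> T) \<circ> orth_proj H V"

locale operator_bounded_below = hilbert_operator H K T + V: closed_subspace H V
  for H :: "('f::rc_field, 'h::banach) inner_structure"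
    and K :: "('f, 'k::banach) inner_structure" and T :: "'h \<Rightarrow> 'k" and V :: "'h set" +
  fixes a :: real
  assumes vanishes_on_orth_compl: "x \<in> orth_compl H V \<Longrightarrow> T x = 0"
    and bound_pos: "0 < a" and lower_bound: "x \<in> V \<Longrightarrow> a * norm x \<le> norm (T x)"
begin

sublocale adj: hilbert_operator K H "adj H K T"
  by (rule hilbert_operator_adj)

lemma apply_orth_proj: "T (orth_proj H V x) = T x"
  using vanishes_on_orth_compl[OF V.diff_orth_proj_in, of x] by (simp add: diff)

lemma orth_proj_adj: "orth_proj H V (adj H K T y) = adj H K T y"
  by (rule H.eq_if_inner_eq) (simp add: V.inner_orth_proj[symmetric] inner_adj apply_orth_proj)

lemma adj_in: "adj H K T y \<in> V"
  using V.orth_proj_in[of "adj H K T y"] by (simp add: orth_proj_adj)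

lemma inner_frame: "hinner H x (adj H K T (T x)) = of_real ((norm (T x))\<^sup>2)"
  by (simp only: inner_adj K.inner_self)

lemma frame_lower_bound:
  assumes "x \<in> V"
  shows "a\<^sup>2 * norm x \<le> norm (adj H K T (T x))"
proof (cases "x = 0")
  case False
  have "(a * norm x)\<^sup>2 \<le> (norm (T x))\<^sup>2"
    using lower_bound[OF assms] bound_pos by (intro power_mono) auto
  also have "\<dots> = norm (hinner H x (adj H K T (T x)))"
    by (simp only: inner_frame norm_of_real abs_power2)
  also have "\<dots> \<le> norm x * norm (adj H K T (T x))" by (rule H.Cauchy_Schwarz)
  finally show ?thesis using False by (simp add: power_mult_distrib power2_eq_square)
qed simp

lemma frame_image: "(adj H K T \<circ> T) ` V = V"
proof -
  interpret frame: hilbert_operator H H "adj H K T \<circ> T"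
    by (rule hilbert_operator_compose[OF hilbert_operator_axioms hilbert_operator_adj])
  interpret frame_image: closed_subspace H "(adj H K T \<circ> T) ` V"
    using bound_pos frame_lower_bound
    by (intro frame.closed_subspace_image[where c = "a\<^sup>2"] V.closed_subspace_axioms) simp_all
  show ?thesis
  proof (rule frame_image.eq_if_no_orthogonal_vector[OF V.subspace])
    show "V \<inter> orth_compl H ((adj H K T \<circ> T) ` V) \<subseteq> {0}"
    proof
      fix x assume "x \<in> V \<inter> orth_compl H ((adj H K T \<circ> T) ` V)"
      then have x: "x \<in> V" "x \<in> orth_compl H ((adj H K T \<circ> T) ` V)" by auto
      then have "hinner H x (adj H K T (T x)) = 0" by (auto dest: orth_complD)
      then have "T x = 0" by (simp add: inner_frame)
      then show "x \<in> {0}" using lower_bound[OF x(1)] bound_pos by (simp add: mult_le_0_iff)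
    qed
  qed (use adj_in in auto)
qed

lemma canonical_dual_op_cases:
  obtains u where "u \<in> V" "canonical_dual_op H K T V h = T u" "adj H K T (T u) = orth_proj H V h"
proof
  let ?u = "inv_into V (adj H K T \<circ> T) (orth_proj H V h)"
  have image: "orth_proj H V h \<in> (adj H K T \<circ> T) ` V"
    unfolding frame_image by (rule V.orth_proj_in)
  show "?u \<in> V" by (rule inv_into_into[OF image])
  show "adj H K T (T ?u) = orth_proj H V h" using f_inv_into_f[OF image] by simp
  show "canonical_dual_op H K T V h = T ?u" by (simp add: canonical_dual_op_def)
qed

lemma adj_canonical_dual_op: "adj H K T (canonical_dual_op H K T V h) = orth_proj H V h"
  by (metis canonical_dual_op_cases)

lemma canonical_dual_op_eqI:
  assumes "u \<in> V" "adj H K T (T u) = orth_proj H V h"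
  shows "canonical_dual_op H K T V h = T u"
proof -
  obtain w where w: "w \<in> V" "canonical_dual_op H K T V h = T w"
    "adj H K T (T w) = orth_proj H V h"
    by (rule canonical_dual_op_cases)
  have "w - u \<in> V" using w assms by (intro H.VS.subspace_diff[OF V.subspace])
  moreover have "adj H K T (T (w - u)) = 0" using w assms by (simp add: diff adj.diff)
  ultimately have "w = u" using frame_lower_bound[of "w - u"] bound_pos by (simp add: mult_le_0_iff)
  with w show ?thesis by simp
qed

lemma canonical_dual_op_diff:
  "canonical_dual_op H K T V (x - y) = canonical_dual_op H K T V x - canonical_dual_op H K T V y"
proof -
  interpret P: hilbert_operator H H "orth_proj H V"
    by unfold_locales (rule V.bounded_operator_orth_proj)
  obtain u where u: "u \<in> V" "canonical_dual_op H K T V x = T u" "adj H K T (T u) = orth_proj H V x"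
    by (rule canonical_dual_op_cases)
  obtain w where w: "w \<in> V" "canonical_dual_op H K T V y = T w" "adj H K T (T w) = orth_proj H V y"
    by (rule canonical_dual_op_cases)
  have "canonical_dual_op H K T V (x - y) = T (u - w)"
    using u w by (intro canonical_dual_op_eqI H.VS.subspace_diff[OF V.subspace])
      (simp_all add: diff adj.diff P.diff)
  then show ?thesis using u w by (simp add: diff)
qed

lemma norm_canonical_dual_op_le: "norm (canonical_dual_op H K T V h) \<le> norm (orth_proj H V h) / a"
proof -
  obtain u where u: "u \<in> V" "canonical_dual_op H K T V h = T u" "adj H K T (T u) = orth_proj H V h"
    by (rule canonical_dual_op_cases)
  have "norm (T u) * norm (T u) = norm (hinner H u (adj H K T (T u)))"
    by (simp only: inner_frame norm_of_real abs_power2 power2_eq_square[symmetric])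
  also have "\<dots> \<le> norm u * norm (orth_proj H V h)" unfolding u(3) by (rule H.Cauchy_Schwarz)
  also have "\<dots> \<le> norm (T u) / a * norm (orth_proj H V h)"
    using lower_bound[OF u(1)] bound_pos
    by (intro mult_right_mono) (simp_all add: pos_le_divide_eq mult.commute)
  finally show ?thesis
    using u(2) bound_pos by (cases "T u = 0") (simp_all add: field_simps)
qed

lemma canonical_dual_op_preimage:
  obtains u where "u \<in> V" "canonical_dual_op H K T V h = T u" "norm u \<le> norm h / a\<^sup>2"
proof -
  obtain u where u: "u \<in> V" "canonical_dual_op H K T V h = T u" "adj H K T (T u) = orth_proj H V h"
    by (rule canonical_dual_op_cases)
  have "a\<^sup>2 * norm u \<le> norm h"
    using frame_lower_bound[OF u(1)] V.norm_orth_proj_le[of h] by (simp add: u(3))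
  then have "norm u \<le> norm h / a\<^sup>2"
    using bound_pos by (simp add: pos_le_divide_eq mult.commute)
  with u that show thesis by blast
qed

lemma norm_diff_canonical_dual_op_adj_le:
  "norm (y - canonical_dual_op H K T V (adj H K T y)) \<le> norm (y - T x)"
proof -
  obtain u where u: "canonical_dual_op H K T V (adj H K T y) = T u" by (rule canonical_dual_op_cases)
  have "adj H K T (y - T u) = 0"
    unfolding u[symmetric] adj.diff adj_canonical_dual_op orth_proj_adj by simp
  then have "hinner K (T (u - x)) (y - T u) = 0" by (simp flip: inner_adj)
  from K.pythagorean[OF this] have "(norm (y - T u))\<^sup>2 \<le> (norm (y - T x))\<^sup>2"
    by (simp add: diff)
  then show ?thesis unfolding u by (rule power2_le_imp_le) simp
qed

lemma norm_canonical_dual_op_adj_diff_le: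
  assumes "hilbert_operator H K S" and close: "\<And>x. norm (T x - S x) \<le> \<mu> * norm x" and "0 \<le> \<mu>"
  shows "norm (canonical_dual_op H K T V (adj H K T y - adj H K S y)) \<le> \<mu> * norm y / a"
proof -
  interpret diff: hilbert_operator H K "\<lambda>x. T x - S x"
    by (rule hilbert_operator_diff[OF assms(1)])
  have "norm (adj H K T y - adj H K S y) \<le> \<mu> * norm y"
    using diff.norm_adj_le[OF close \<open>0 \<le> \<mu>\<close>] by (simp only: adj_operator_diff[OF assms(1)])
  then have "norm (orth_proj H V (adj H K T y - adj H K S y)) \<le> \<mu> * norm y"
    by (rule order_trans[OF V.norm_orth_proj_le])
  then show ?thesis
    using bound_pos by (intro order_trans[OF norm_canonical_dual_op_le] divide_right_mono) simp_all
qed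

lemma norm_canonical_dual_op_diff_orth_proj_le:
  assumes "closed_subspace H W"
  shows "norm (canonical_dual_op H K T V (h - orth_proj H W h)) \<le> delta H V W * norm h / a"
proof -
  interpret W: closed_subspace H W by fact
  show ?thesis
    using W.norm_orth_proj_diff_orth_proj_le[OF V.closed_subspace_axioms] bound_pos
    by (intro order_trans[OF norm_canonical_dual_op_le] divide_right_mono) simp_all
qed

text \<open>
  Estimating \<open>S y\<close> for \<open>y \<in> W\<close> directly through the projection of \<open>y\<close> to \<open>V\<close> would lose a factor
  \<open>sqrt (1 - (gap H V W)\<^sup>2)\<close>; writing \<open>y\<close> as the projection of some \<open>x \<in> V\<close> does not.
\<close>

lemma operator_bounded_below_perturbation:
  assumes "hilbert_operator H K S" and "closed_subspace H W"
    and S_vanishes: "\<And>x. x \<in> orth_compl H W \<Longrightarrow> S x = 0"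
    and close: "\<And>x. norm (T x - S x) \<le> \<mu> * norm x" and "\<mu> < a" and "gap H V W < 1"
  shows "operator_bounded_below H K S W (a - \<mu>)"
proof -
  interpret S: hilbert_operator H K S by fact
  interpret W: closed_subspace H W by fact
  have "(a - \<mu>) * norm y \<le> norm (S y)" if "y \<in> W" for y
  proof -
    obtain x where x: "x \<in> V" "y = orth_proj H W x"
      using V.image_orth_proj_if_gap_less_1[OF assms(2,6)] \<open>y \<in> W\<close> by blast
    have "(a - \<mu>) * norm y \<le> (a - \<mu>) * norm x"
      using W.norm_orth_proj_le \<open>\<mu> < a\<close> by (simp add: x)
    also have "\<dots> \<le> norm (S x)"
      using lower_bound[OF x(1)] close[of x] norm_triangle_ineq2[of "T x" "S x"]
      by (simp add: algebra_simps)
    also have "S x = S y"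
      using S_vanishes[OF W.diff_orth_proj_in, of x] by (simp add: x S.diff)
    finally show ?thesis .
  qed
  with \<open>\<mu> < a\<close> S_vanishes show ?thesis by unfold_locales simp_all
qed

end

lemma norm_canonical_dual_op_perturbation_le:
  assumes "operator_bounded_below H K X V a" and "operator_bounded_below H K Y W b"
    and close: "\<And>x. norm (X x - Y x) \<le> \<mu> * norm x" and "0 \<le> \<mu>"
  shows "norm (canonical_dual_op H K X V h - canonical_dual_op H K Y W h)
    \<le> (\<mu> / a\<^sup>2 + (\<mu> / a + delta H W V) / b) * norm h"
proof -
  interpret X: operator_bounded_below H K X V a by fact
  interpret Y: operator_bounded_below H K Y W b by fact
  let ?dualX = "canonical_dual_op H K X V" and ?dualY = "canonical_dual_op H K Y W"
  let ?X' = "adj H K X" and ?Y' = "adj H K Y"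
  obtain u where u: "u \<in> V" "?dualX h = X u" "norm u \<le> norm h / a\<^sup>2"
    by (rule X.canonical_dual_op_preimage)
  have "norm (?dualX h - ?dualY (?Y' (?dualX h))) \<le> norm (X u - Y u)"
    unfolding u(2) by (rule Y.norm_diff_canonical_dual_op_adj_le)
  also have "\<dots> \<le> \<mu> * norm u" by (rule close)
  also have "\<dots> \<le> \<mu> * (norm h / a\<^sup>2)" by (intro mult_left_mono u(3) \<open>0 \<le> \<mu>\<close>)
  finally have off_range: "norm (?dualX h - ?dualY (?Y' (?dualX h))) \<le> \<mu> * (norm h / a\<^sup>2)" .
  have "norm (?dualY (?Y' (?dualX h) - ?X' (?dualX h))) \<le> \<mu> * norm (?dualX h) / b"
    using close \<open>0 \<le> \<mu>\<close>
    by (intro Y.norm_canonical_dual_op_adj_diff_le X.hilbert_operator_axioms)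
      (simp_all add: norm_minus_commute)
  also have "\<dots> \<le> \<mu> * (norm h / a) / b"
  proof (intro divide_right_mono mult_left_mono \<open>0 \<le> \<mu>\<close>)
    show "norm (?dualX h) \<le> norm h / a"
      using X.V.norm_orth_proj_le X.bound_pos
      by (intro order_trans[OF X.norm_canonical_dual_op_le] divide_right_mono) simp_all
  qed (use Y.bound_pos in simp)
  finally have adj_diff: "norm (?dualY (?Y' (?dualX h) - ?X' (?dualX h))) \<le> \<mu> * (norm h / a) / b" .
  have off_subspace: "norm (?dualY (h - orth_proj H V h)) \<le> delta H W V * norm h / b"
    by (rule Y.norm_canonical_dual_op_diff_orth_proj_le[OF X.V.closed_subspace_axioms])
  let ?p = "?dualX h - ?dualY (?Y' (?dualX h))"
    and ?q = "?dualY (?Y' (?dualX h) - ?X' (?dualX h))"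
    and ?r = "?dualY (h - orth_proj H V h)"
  have decomposition: "?dualX h - ?dualY h = ?p + ?q - ?r"
    by (simp add: Y.canonical_dual_op_diff X.adj_canonical_dual_op)
  have "norm (?dualX h - ?dualY h) \<le> norm ?p + norm ?q + norm ?r"
    unfolding decomposition
    using norm_triangle_ineq4[of "?p + ?q" ?r] norm_triangle_ineq[of ?p ?q] by linarith
  also have "\<dots> \<le> \<mu> * (norm h / a\<^sup>2) + \<mu> * (norm h / a) / b + delta H W V * norm h / b"
    by (intro add_mono off_range adj_diff off_subspace)
  finally show ?thesis by (simp add: add_divide_distrib distrib_right)
qed

section \<open>Operator-valued Bessel sequences\<close>

locale operator_valued_bessel_sequence = H: hilbert_space H + K: hilbert_space K
  for H :: "('f::rc_field, 'h::banach) inner_structure"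
    and K :: "('f, 'k::banach) inner_structure" +
  fixes I :: "nat set" and A :: "nat \<Rightarrow> 'h \<Rightarrow> 'k"
  assumes bessel: "bessel_sequence H K I A"
begin

lemma hilbert_operator_nth: "i \<in> I \<Longrightarrow> hilbert_operator H K (A i)"
  using bessel by unfold_locales (simp add: bessel_sequence_def)

lemma summable: "(\<lambda>i. (norm (A i x))\<^sup>2) summable_on I"
  using bessel by (auto simp: bessel_sequence_def)

lemma upper_bound_exists:
  obtains \<beta> where "\<beta> > 0" "\<And>x. (\<Sum>\<^sub>\<infinity>i\<in>I. (norm (A i x))\<^sup>2) \<le> \<beta> * (norm x)\<^sup>2"
  using bessel by (auto simp: bessel_sequence_def)

lemma ell2_nth_analysis_op: "ell2_nth (analysis_op I A x) i = (if i \<in> I then A i x else 0)"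
proof -
  have "(\<lambda>i. (norm (if i \<in> I then A i x else 0))\<^sup>2) summable_on UNIV
      \<longleftrightarrow> (\<lambda>i. (norm (A i x))\<^sup>2) summable_on I"
    by (rule summable_on_cong_neutral) auto
  then show ?thesis by (simp add: summable analysis_op_def Abs_ell2_inverse)
qed

lemma norm_analysis_op_sq: "(norm (analysis_op I A x))\<^sup>2 = (\<Sum>\<^sub>\<infinity>i\<in>I. (norm (A i x))\<^sup>2)"
proof -
  have "(norm (analysis_op I A x))\<^sup>2 = (\<Sum>\<^sub>\<infinity>i. (norm (if i \<in> I then A i x else 0))\<^sup>2)"
    unfolding norm_ell2.rep_eq by (simp add: infsum_nonneg ell2_nth_analysis_op)
  also have "\<dots> = (\<Sum>\<^sub>\<infinity>i\<in>I. (norm (A i x))\<^sup>2)"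
    by (rule infsum_cong_neutral) auto
  finally show ?thesis .
qed

lemma bounded_linear_analysis_op: "bounded_linear (analysis_op I A)"
proof -
  obtain \<beta> where \<beta>: "\<beta> > 0" "\<And>x. (\<Sum>\<^sub>\<infinity>i\<in>I. (norm (A i x))\<^sup>2) \<le> \<beta> * (norm x)\<^sup>2"
    by (rule upper_bound_exists) blast
  have linear: "linear (A i)" if "i \<in> I" for i
  proof -
    interpret hilbert_operator H K "A i" by (rule hilbert_operator_nth[OF that])
    show ?thesis by (rule linear_axioms)
  qed
  show ?thesis
  proof (rule bounded_linear_intro[where K = "sqrt \<beta>"])
    show "analysis_op I A (x + y) = analysis_op I A x + analysis_op I A y"
      "analysis_op I A (r *\<^sub>R x) = r *\<^sub>R analysis_op I A x" for x y r
      by (auto simp: ell2_nth_inject[symmetric] fun_eq_iff ell2_nth_analysis_op plus_ell2.rep_eq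
          scaleR_ell2.rep_eq linear_add[OF linear] linear_scale[OF linear])
    show "norm (analysis_op I A x) \<le> norm x * sqrt \<beta>" for x
      by (rule power2_le_imp_le)
        (use \<beta> in \<open>auto simp: norm_analysis_op_sq power_mult_distrib mult.commute\<close>)
  qed
qed

lemma analysis_op_scale:
  "analysis_op I A (hscale H c x) = hscale (ell2_structure K) c (analysis_op I A x)"
proof -
  have "(\<lambda>i. if i \<in> I then A i (hscale H c x) else 0)
      = (\<lambda>i. hscale K c (ell2_nth (analysis_op I A x) i))"
    by (auto simp: ell2_nth_analysis_op hilbert_operator.apply_scale[OF hilbert_operator_nth]
        K.VS.scale_zero_right)
  then show ?thesis by (simp add: ell2_structure_def analysis_op_def)
qed

sublocale analysis: hilbert_operator H "ell2_structure K" "analysis_op I A"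
proof -
  interpret ell2: hilbert_space "ell2_structure K"
    by (rule hilbert_space_ell2[OF K.hilbert_space_axioms])
  show "hilbert_operator H (ell2_structure K) (analysis_op I A)"
    by unfold_locales
      (simp add: bounded_operator_def bounded_linear_analysis_op analysis_op_scale)
qed

sublocale range_space: closed_subspace H "range_space H K I A"
  by unfold_locales (simp_all add: range_space_def H.subspace_closure)

lemma analysis_op_eq_0_if_orthogonal:
  assumes "x \<in> orth_compl H (range_space H K I A)"
  shows "analysis_op I A x = 0"
proof -
  have "A i x = 0" if "i \<in> I" for i
  proof -
    interpret A: hilbert_operator H K "A i" by (rule hilbert_operator_nth[OF that])
    have "adj H K (A i) (A i x) \<in> range_space H K I A"
      unfolding range_space_def using that
      by (intro subsetD[OF closure_subset] H.VS.span_base) auto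
    then have "hinner K (A i x) (A i x) = 0"
      unfolding A.inner_adj[symmetric] by (rule orth_complD[OF assms])
    then show ?thesis by simp
  qed
  then show ?thesis
    by (auto simp: ell2_nth_inject[symmetric] fun_eq_iff ell2_nth_analysis_op zero_ell2.rep_eq)
qed

lemma frame_sequence_bounds_iff_bounded_below:
  "(\<exists>\<beta>. frame_sequence_bounds H K I A \<alpha> \<beta>)
    \<longleftrightarrow> operator_bounded_below H (ell2_structure K) (analysis_op I A) (range_space H K I A) (sqrt \<alpha>)"
    (is "?frame \<longleftrightarrow> ?bounded_below")
proof
  have sqrt_bound_iff: "\<alpha> * (norm x)\<^sup>2 \<le> (\<Sum>\<^sub>\<infinity>i\<in>I. (norm (A i x))\<^sup>2)
      \<longleftrightarrow> sqrt \<alpha> * norm x \<le> norm (analysis_op I A x)" if "0 < \<alpha>" for x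
    using that power_mono_iff[of "sqrt \<alpha> * norm x" "norm (analysis_op I A x)" 2]
    by (simp add: norm_analysis_op_sq power_mult_distrib)
  show ?bounded_below if ?frame
    using that sqrt_bound_iff analysis_op_eq_0_if_orthogonal
    by unfold_locales (auto simp: frame_sequence_bounds_def)
  show ?frame if ?bounded_below
  proof -
    interpret operator_bounded_below H "ell2_structure K" "analysis_op I A" "range_space H K I A"
      "sqrt \<alpha>" by fact
    obtain \<beta> where "\<beta> > 0" "\<And>x. (\<Sum>\<^sub>\<infinity>i\<in>I. (norm (A i x))\<^sup>2) \<le> \<beta> * (norm x)\<^sup>2"
      by (rule upper_bound_exists) blast
    then have "frame_sequence_bounds H K I A \<alpha> \<beta>"
      using bound_pos lower_bound sqrt_bound_iff summable bessel
      by (simp add: frame_sequence_bounds_def bessel_sequence_def)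
    then show ?thesis by blast
  qed
qed

end

lemma analysis_op_canonical_dual:
  "analysis_op I (canonical_dual H K I A)
    = canonical_dual_op H (ell2_structure K) (analysis_op I A) (range_space H K I A)"
  by (simp add: analysis_op_def canonical_dual_op_def canonical_dual_def frame_op_def fun_eq_iff
      cong: if_cong)

locale bessel_perturbation =
  A: operator_valued_bessel_sequence H K I A + B: operator_valued_bessel_sequence H K I B
  for H :: "('f::rc_field, 'h::banach) inner_structure"
    and K :: "('f, 'k::banach) inner_structure"
    and I :: "nat set" and A B :: "nat \<Rightarrow> 'h \<Rightarrow> 'k" +
  fixes \<mu> :: real
  assumes perturbation: "perturbation H K I \<mu> A B"
begin

lemma norm_analysis_op_diff_le: "norm (analysis_op I A x - analysis_op I B x) \<le> \<mu> * norm x"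
proof -
  interpret diff: hilbert_operator H "ell2_structure K" "\<lambda>x. analysis_op I A x - analysis_op I B x"
    by (rule A.analysis.hilbert_operator_diff[OF B.analysis.hilbert_operator_axioms])
  have "norm (analysis_op I A x - analysis_op I B x)
      \<le> onorm (\<lambda>x. analysis_op I A x - analysis_op I B x) * norm x"
    by (rule onorm[OF diff.bounded_linear_axioms])
  also have "\<dots> \<le> \<mu> * norm x"
    using perturbation by (intro mult_right_mono) (simp_all add: perturbation_def)
  finally show ?thesis .
qed

lemma frame_sequence_bounds_perturbation:
  assumes "\<exists>\<beta>. frame_sequence_bounds H K I A \<alpha> \<beta>"
    and "\<mu> < sqrt \<alpha>" and "gap H (range_space H K I A) (range_space H K I B) < 1"
  shows "\<exists>\<beta>. frame_sequence_bounds H K I B ((sqrt \<alpha> - \<mu>)\<^sup>2) \<beta>"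
proof -
  interpret X: operator_bounded_below H "ell2_structure K" "analysis_op I A" "range_space H K I A"
    "sqrt \<alpha>"
    using assms(1) by (simp only: A.frame_sequence_bounds_iff_bounded_below)
  have "operator_bounded_below H (ell2_structure K) (analysis_op I B) (range_space H K I B)
      (sqrt \<alpha> - \<mu>)"
    by (rule X.operator_bounded_below_perturbation[OF B.analysis.hilbert_operator_axioms
          B.range_space.closed_subspace_axioms B.analysis_op_eq_0_if_orthogonal
          norm_analysis_op_diff_le assms(2,3)])
  then show ?thesis
    using assms(2) by (simp add: B.frame_sequence_bounds_iff_bounded_below)
qed

lemma onorm_canonical_dual_diff_le:
  assumes "\<exists>\<beta>. frame_sequence_bounds H K I A \<alpha> \<beta>" and "\<exists>\<beta>. frame_sequence_bounds H K I B \<gamma> \<beta>"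
    and "0 \<le> \<mu>"
  shows "onorm (\<lambda>x. analysis_op I (canonical_dual H K I A) x - analysis_op I (canonical_dual H K I B) x)
    \<le> \<mu> / \<alpha> + (\<mu> / sqrt \<alpha> + delta H (range_space H K I B) (range_space H K I A)) / sqrt \<gamma>"
proof -
  interpret X: operator_bounded_below H "ell2_structure K" "analysis_op I A" "range_space H K I A"
    "sqrt \<alpha>"
    using assms(1) by (simp only: A.frame_sequence_bounds_iff_bounded_below)
  interpret Y: operator_bounded_below H "ell2_structure K" "analysis_op I B" "range_space H K I B"
    "sqrt \<gamma>"
    using assms(2) by (simp only: B.frame_sequence_bounds_iff_bounded_below)
  let ?bound = "\<mu> / (sqrt \<alpha>)\<^sup>2
    + (\<mu> / sqrt \<alpha> + delta H (range_space H K I B) (range_space H K I A)) / sqrt \<gamma>"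
  have "0 \<le> ?bound"
    using \<open>0 \<le> \<mu>\<close> X.bound_pos Y.bound_pos A.range_space.delta_nonneg[OF B.range_space.zero_in]
    by (intro add_nonneg_nonneg divide_nonneg_nonneg) auto
  then have "onorm (\<lambda>x. analysis_op I (canonical_dual H K I A) x
      - analysis_op I (canonical_dual H K I B) x) \<le> ?bound"
    unfolding analysis_op_canonical_dual
    by (rule onorm_bound) (rule norm_canonical_dual_op_perturbation_le[OF
          X.operator_bounded_below_axioms Y.operator_bounded_below_axioms
          norm_analysis_op_diff_le \<open>0 \<le> \<mu>\<close>])
  then show ?thesis using X.bound_pos by simp
qed

end

lemma dual_perturbation_constant_le:
  fixes a \<mu> \<Delta> :: real
  assumes "0 \<le> \<mu>" "\<mu> < a" "0 \<le> \<Delta>"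
  shows "\<mu> / a\<^sup>2 + (\<mu> / a + \<Delta>) / (a - \<mu>) \<le> (2 * \<mu> + (2 * a - \<mu>) * \<Delta>) / (a * (a - \<mu>))"
proof -
  define b where "b = a - \<mu>"
  have ab: "0 < b" "b \<le> a" using assms by (simp_all add: b_def)
  have "\<mu> / a\<^sup>2 \<le> \<mu> / (a * b)"
    using assms ab by (intro divide_left_mono) (simp_all add: power2_eq_square)
  moreover have "0 \<le> \<Delta> / a" using assms by simp
  moreover have "\<mu> / (a * b) + (\<mu> / a + \<Delta>) / b + \<Delta> / a = (2 * \<mu> + (a + b) * \<Delta>) / (a * b)"
    using ab by (simp add: field_simps)
  ultimately have "\<mu> / a\<^sup>2 + (\<mu> / a + \<Delta>) / b \<le> (2 * \<mu> + (a + b) * \<Delta>) / (a * b)" by linarith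
  then show ?thesis by (simp add: b_def)
qed

theorem theorem4p9:
  fixes H :: "('f::rc_field, 'h::banach) inner_structure"
    and K :: "('f, 'k::banach) inner_structure"
    and I :: "nat set"
    and A B :: "nat \<Rightarrow> 'h \<Rightarrow> 'k"
    and \<alpha> \<mu> \<Delta> :: real
  assumes "hilbert_space H" and "hilbert_space K"
    and "\<exists>\<beta>. frame_sequence_bounds H K I A \<alpha> \<beta>"
    and "0 < \<mu>" and "\<mu> < sqrt \<alpha>"
    and "perturbation H K I \<mu> A B"
    and "\<Delta> = gap H (range_space H K I A) (range_space H K I B)"
    and "\<Delta> < 1"
  shows "frame_sequence H K I B \<and>
    onorm (\<lambda>x. analysis_op I (canonical_dual H K I A) x - analysis_op I (canonical_dual H K I B) x)
      \<le> (2 * \<mu> + (2 * sqrt \<alpha> - \<mu>) * \<Delta>) / (sqrt \<alpha> * (sqrt \<alpha> - \<mu>))"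
proof
  interpret H: hilbert_space H by fact
  interpret K: hilbert_space K by fact
  interpret bessel_perturbation H K I A B \<mu>
    using assms(6) by unfold_locales (simp_all add: perturbation_def)
  let ?V = "range_space H K I A" and ?W = "range_space H K I B"
  have frame_B: "\<exists>\<beta>. frame_sequence_bounds H K I B ((sqrt \<alpha> - \<mu>)\<^sup>2) \<beta>"
    using assms(3,5,7,8) by (simp add: frame_sequence_bounds_perturbation)
  then show "frame_sequence H K I B" by (auto simp: frame_sequence_def)
  have "0 \<le> \<mu>" "0 \<le> \<alpha>" using assms(3,4) by (auto simp: frame_sequence_bounds_def)
  have "0 \<le> \<Delta>"
    unfolding assms(7) by (rule B.range_space.gap_nonneg[OF A.range_space.zero_in])
  have "onorm (\<lambda>x. analysis_op I (canonical_dual H K I A) x - analysis_op I (canonical_dual H K I B) x)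
      \<le> \<mu> / \<alpha> + (\<mu> / sqrt \<alpha> + delta H ?W ?V) / (sqrt \<alpha> - \<mu>)"
    using onorm_canonical_dual_diff_le[OF assms(3) frame_B \<open>0 \<le> \<mu>\<close>] assms(5) by simp
  also have "\<dots> \<le> \<mu> / (sqrt \<alpha>)\<^sup>2 + (\<mu> / sqrt \<alpha> + \<Delta>) / (sqrt \<alpha> - \<mu>)"
    using assms(5,7) \<open>0 \<le> \<alpha>\<close> by (simp add: gap_def divide_right_mono)
  also have "\<dots> \<le> (2 * \<mu> + (2 * sqrt \<alpha> - \<mu>) * \<Delta>) / (sqrt \<alpha> * (sqrt \<alpha> - \<mu>))"
    by (rule dual_perturbation_constant_le[OF \<open>0 \<le> \<mu>\<close> assms(5) \<open>0 \<le> \<Delta>\<close>])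
  finally show "onorm (\<lambda>x. analysis_op I (canonical_dual H K I A) x
      - analysis_op I (canonical_dual H K I B) x)
      \<le> (2 * \<mu> + (2 * sqrt \<alpha> - \<mu>) * \<Delta>) / (sqrt \<alpha> * (sqrt \<alpha> - \<mu>))" .
qed

end
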